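(* Let $\lambda\ge 0$, $0\le\alpha<1$, $0\le k<\infty$, $u\in\mathbb{N}=\{1,2,3,\dots\}$, $v\in\mathbb{N}_0=\mathbb{N}\cup\{0\}$ with $u>v$. Let $f_u\in k\text{-}UTH(u,v,\alpha,\lambda)$, written as $$f_u(z)=z-\sum_{n=2}^\infty|a_n|z^n+(-1)^{u-1}\sum_{n=1}^\infty|b_n|\overline{z}^n,\qquad |b_1|<1.$$ Then for $|z|=r<1$ $$|f_u(z)|\le(1+|b_1|)r+\left\{\sigma-\tau|b_1|\right\}r^2$$ and $$|f_u(z)|\ge(1-|b_1|)r-\left\{\sigma-\tau|b_1|\right\}r^2,$$ where $$\sigma=\frac{1-\alpha}{(1+\lambda)^u(1+k)-(1+\lambda)^v(k+\alpha)},\qquad \tau=\frac{(1+k)-(-1)^{v-u}(k+\alpha)}{(1+\lambda)^u(1+k)-(1+\lambda)^v(k+\alpha)}.$$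
   Context: $U=\{z\in\mathbb{C}:|z|<1\}$. $SH$ is the class of functions $f=h+\overline{g}$ ($h,g$ analytic in $U$) that are harmonic, univalent and sense-preserving in $U$ with $f(0)=0$, $f_z(0)=1$; $h$ and $g$ are written $h(z)=z+\sum_{n\ge2}a_nz^n$, $g(z)=\sum_{n\ge1}b_nz^n$, $|b_1|<1$. Al-Oboudi operator: for $\lambda\ge0$ and $u\in\mathbb{N}_0$, $D^uh(z)=z+\sum_{n=2}^\infty[1+(n-1)\lambda]^ua_nz^n$, $D^ug(z)=\sum_{n=1}^\infty[1+(n-1)\lambda]^ub_nz^n$, and $D^uf(z)=D^uh(z)+(-1)^u\overline{D^ug(z)}$. For $0\le\alpha<1$, $0\le k<\infty$, $u\in\mathbb{N}$, $v\in\mathbb{N}_0$, $u>v$, $\lambda\ge0$, the class $k\text{-}USH(u,v,\alpha,\lambda)$ consists of the functions $f=h+\overline{g}\in SH$ satisfying $$\operatorname{Re}\left\{(1+ke^{i\phi})\frac{D^uf(z)}{D^vf(z)}-ke^{i\phi}\right\}\ge\alpha$$ for all $z\in U\setminus\{0\}$ and all real $\phi$. The subclass $k\text{-}UTH(u,v,\alpha,\lambda)$ of $k\text{-}USH(u,v,\alpha,\lambda)$ consists of those members of the form $f_u=h+\overline{g_u}$ with $h(z)=z-\sum_{n\ge2}|a_n|z^n$, $g_u(z)=(-1)^{u-1}\sum_{n\ge1}|b_n|z^n$, $|b_1|<1$. *)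

theory Defs
  imports "HOL-Complex_Analysis.Complex_Analysis"
begin

abbreviation unit_disc :: "complex set" where
  "unit_disc \<equiv> ball 0 1"

text \<open>A function on the disc is modelled by a total function on the complex plane; only its values
  on the disc matter. The normalisation \<open>g 0 = 0\<close> makes the pair \<open>(h, g)\<close> unique on the disc.
  Such an \<open>f\<close> is automatically harmonic.\<close>

definition canonical_rep ::
    "(complex \<Rightarrow> complex) \<Rightarrow> (complex \<Rightarrow> complex) \<Rightarrow> (complex \<Rightarrow> complex) \<Rightarrow> bool" where
  "canonical_rep f h g \<longleftrightarrow>
     h holomorphic_on unit_disc \<and> g holomorphic_on unit_disc \<and> g 0 = 0 \<and>
     (\<forall>z\<in>unit_disc. f z = h z + cnj (g z))"

text \<open>The Wirtinger derivative \<open>f\<^sub>z = (f\<^sub>x - \<i> f\<^sub>y) / 2\<close>.\<close>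

definition wirtinger_dz :: "(complex \<Rightarrow> complex) \<Rightarrow> complex \<Rightarrow> complex" where
  "wirtinger_dz f z =
     (frechet_derivative f (at z) 1 - \<i> * frechet_derivative f (at z) \<i>) / 2"

text \<open>The real Jacobian determinant of \<open>f\<close> as a map of the plane, the partial derivatives in
  the directions \<open>x\<close> and \<open>y\<close> being the values of the derivative at \<open>1\<close> and \<open>\<i>\<close>.\<close>

definition real_jacobian :: "(complex \<Rightarrow> complex) \<Rightarrow> complex \<Rightarrow> real" where
  "real_jacobian f z =
     Re (frechet_derivative f (at z) 1) * Im (frechet_derivative f (at z) \<i>) -
     Re (frechet_derivative f (at z) \<i>) * Im (frechet_derivative f (at z) 1)"

definition sense_preserving_on :: "complex set \<Rightarrow> (complex \<Rightarrow> complex) \<Rightarrow> bool" where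
  "sense_preserving_on S f \<longleftrightarrow> (\<forall>z\<in>S. real_jacobian f z > 0)"

definition SH :: "(complex \<Rightarrow> complex) set" where
  "SH = {f. (\<exists>h g. canonical_rep f h g) \<and> inj_on f unit_disc \<and>
            sense_preserving_on unit_disc f \<and> f 0 = 0 \<and> wirtinger_dz f 0 = 1}"

text \<open>The summand with index \<open>n\<close> belongs to the power \<open>Suc n\<close>, so its factor
  \<open>1 + (Suc n - 1) * lam\<close> is \<open>1 + n * lam\<close>. The first summand is \<open>deriv h 0 * z\<close>, which is
  \<open>z\<close> for normalised \<open>h\<close>.\<close>

definition al_oboudi :: "real \<Rightarrow> nat \<Rightarrow> (complex \<Rightarrow> complex) \<Rightarrow> complex \<Rightarrow> complex" where
  "al_oboudi lam u h z =
     (\<Sum>n. of_real ((1 + real n * lam) ^ u) * fps_nth (fps_expansion h 0) (Suc n) * z ^ Suc n)"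

definition al_oboudi_harmonic ::
    "real \<Rightarrow> nat \<Rightarrow> (complex \<Rightarrow> complex) \<Rightarrow> (complex \<Rightarrow> complex) \<Rightarrow> complex \<Rightarrow> complex" where
  "al_oboudi_harmonic lam u h g z =
     al_oboudi lam u h z + (- 1) ^ u * cnj (al_oboudi lam u g z)"

text \<open>Since division by zero is total here, the requirement that the quotient is defined has to
  be stated explicitly.\<close>

definition USH :: "real \<Rightarrow> nat \<Rightarrow> nat \<Rightarrow> real \<Rightarrow> real \<Rightarrow> (complex \<Rightarrow> complex) set" where
  "USH k u v \<alpha> lam =
     {f \<in> SH. \<exists>h g. canonical_rep f h g \<and>
        (\<forall>z \<in> unit_disc - {0}. al_oboudi_harmonic lam v h g z \<noteq> 0 \<and>
           (\<forall>\<phi>::real.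
              Re ((1 + of_real k * cis \<phi>) *
                    (al_oboudi_harmonic lam u h g z / al_oboudi_harmonic lam v h g z) -
                  of_real k * cis \<phi>) \<ge> \<alpha>))}"

text \<open>Only \<open>a n\<close> with \<open>n \<ge> 2\<close> and \<open>b n\<close> with \<open>n \<ge> 1\<close> matter.\<close>

definition negative_form ::
    "nat \<Rightarrow> (nat \<Rightarrow> complex) \<Rightarrow> (nat \<Rightarrow> complex) \<Rightarrow> (complex \<Rightarrow> complex) \<Rightarrow> bool" where
  "negative_form u a b f \<longleftrightarrow> cmod (b 1) < 1 \<and>
     (\<exists>h g. \<forall>z\<in>unit_disc.
        (\<lambda>n. of_real (cmod (a (n + 2))) * z ^ (n + 2)) sums (z - h z) \<and>
        (\<lambda>n. (- 1) ^ (u - 1) * of_real (cmod (b (n + 1))) * z ^ (n + 1)) sums g z \<and>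
        f z = h z + cnj (g z))"

definition UTH :: "real \<Rightarrow> nat \<Rightarrow> nat \<Rightarrow> real \<Rightarrow> real \<Rightarrow> (complex \<Rightarrow> complex) set" where
  "UTH k u v \<alpha> lam = {f \<in> USH k u v \<alpha> lam. \<exists>a b. negative_form u a b f}"

end

theory Submission
  imports Defs
begin

text \<open>
  Everything follows from looking at the defining inequality along the positive radius. For
  \<open>z = x \<in> (0, 1)\<close> and \<open>\<phi> = 0\<close> the sign pattern of the coefficients makes
  \<open>D\<^sup>u f(x)\<close> and \<open>D\<^sup>v f(x)\<close> real, namely with \<open>\<gamma>\<^sub>n = 1 + (n - 1) \<lambda>\<close> and \<open>s = (- 1)\<^sup>v\<^sup>-\<^sup>u\<close>
  equal to \<open>x - \<Sum> \<gamma>\<^sub>n\<^sup>u (|a\<^sub>n| + |b\<^sub>n|) x\<^sup>n\<close> and \<open>x - \<Sum> \<gamma>\<^sub>n\<^sup>v (|a\<^sub>n| + s |b\<^sub>n|) x\<^sup>n\<close>, where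
  \<open>|a\<^sub>n|\<close> enters for \<open>n \<ge> 2\<close> only. The
  denominator \<open>D\<^sup>v f(x) / x\<close> has no zero and tends to \<open>1 - s |b\<^sub>1| > 0\<close> at the origin, so it is
  positive, and the inequality may be multiplied out to
  \<open>(1 + k) D\<^sup>u f(x) - (k + \<alpha>) D\<^sup>v f(x) \<ge> 0\<close>. Dividing by \<open>x\<close> and letting \<open>x \<rightarrow> 1\<close> gives
  \<open>\<Sum>\<^sub>n\<^sub>\<ge>\<^sub>2 (\<gamma>\<^sub>n\<^sup>u (1 + k) - \<gamma>\<^sub>n\<^sup>v (k + \<alpha>)) |a\<^sub>n| + \<Sum>\<^sub>n\<^sub>\<ge>\<^sub>2 (\<gamma>\<^sub>n\<^sup>u (1 + k) - s \<gamma>\<^sub>n\<^sup>v (k + \<alpha>)) |b\<^sub>n|\<close>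
  \<open>\<le> 1 - \<alpha> - (1 + k - s (k + \<alpha>)) |b\<^sub>1|\<close>.

  Each weight on the left is at least \<open>K = (1 + \<lambda>)\<^sup>u (1 + k) - (1 + \<lambda>)\<^sup>v (k + \<alpha>)\<close>, because
  \<open>y\<^sup>u (1 + k) - y\<^sup>v (k + \<alpha>)\<close> increases on \<open>y \<ge> 1\<close>. Hence
  \<open>\<Sum>\<^sub>n\<^sub>\<ge>\<^sub>2 (|a\<^sub>n| + |b\<^sub>n|) \<le> \<sigma> - \<tau> |b\<^sub>1|\<close> (lemma \<open>uniform_starlike_tail_bound\<close>), and the two estimates
  are the triangle inequality applied to \<open>f\<close> minus its linear part \<open>z \<plusminus> |b\<^sub>1| cnj z\<close>.

  Membership in the class and the series expansion each come with their own analytic and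
  co-analytic part; \<open>harmonic_decomposition_unique\<close> identifies them, so that the operator,
  which is defined through the Taylor coefficients of one pair, can be computed from the other.
\<close>

section \<open>Uniqueness of the harmonic decomposition\<close>

text \<open>The open mapping theorem: a nonempty open set cannot lie on the imaginary axis.\<close>

lemma holomorphic_Re_zero_imp_constant:
  assumes "f holomorphic_on S" "open S" "connected S" "\<And>z. z \<in> S \<Longrightarrow> Re (f z) = 0"
  shows "f constant_on S"
proof (rule ccontr)
  assume nc: "\<not> f constant_on S"
  then have ne: "S \<noteq> {}" by (auto simp: constant_on_def)
  have "open (f ` S)"
    using open_mapping_thm[OF assms(1,2,3,2) _ nc] by simp
  moreover obtain z where z: "z \<in> S" using ne by auto
  ultimately obtain e where e: "e > 0" "ball (f z) e \<subseteq> f ` S"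
    by (meson image_eqI openE)
  then have "f z + of_real (e/2) \<in> ball (f z) e" by (simp add: dist_norm)
  then obtain w where "w \<in> S" "f w = f z + of_real (e/2)" using e by force
  with assms(4)[of w] assms(4)[OF z] e(1) show False by simp
qed

text \<open>The differences \<open>p\<close> of the analytic and \<open>q\<close> of the co-analytic parts satisfy
  \<open>p = - cnj q\<close>. Then \<open>p + q\<close> is purely imaginary and \<open>p - q\<close> is real, so both are constant.\<close>

lemma harmonic_decomposition_unique:
  assumes hol: "h1 holomorphic_on S" "h2 holomorphic_on S" "g1 holomorphic_on S" "g2 holomorphic_on S"
    and S: "open S" "connected S"
    and eq: "\<And>z. z \<in> S \<Longrightarrow> h1 z + cnj (g1 z) = h2 z + cnj (g2 z)"
    and base: "w \<in> S" "g1 w = g2 w"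
    and z: "z \<in> S"
  shows "h1 z = h2 z \<and> g1 z = g2 z"
proof -
  define p q where "p = (\<lambda>z. h1 z - h2 z)" and "q = (\<lambda>z. g1 z - g2 z)"
  have pq: "p z = - cnj (q z)" if "z \<in> S" for z
    using eq[OF that] by (simp add: p_def q_def algebra_simps)
  have hpq: "p holomorphic_on S" "q holomorphic_on S"
    unfolding p_def q_def by (intro holomorphic_intros hol)+
  have "(\<lambda>z. p z + q z) constant_on S"
    by (rule holomorphic_Re_zero_imp_constant) (auto intro!: holomorphic_intros hpq S simp: pq)
  moreover have "(\<lambda>z. \<i> * (p z - q z)) constant_on S"
    by (rule holomorphic_Re_zero_imp_constant) (auto intro!: holomorphic_intros hpq S simp: pq)
  ultimately have "p z + q z = p w + q w" "\<i> * (p z - q z) = \<i> * (p w - q w)"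
    using z base(1) unfolding constant_on_def by metis+
  then have "p z + q z = p w + q w" "p z - q z = p w - q w" by simp_all
  moreover have "q w = 0" using base by (simp add: q_def)
  moreover have "p w = 0" using pq[OF base(1)] \<open>q w = 0\<close> by simp
  ultimately have "p z + q z = 0" "p z = q z" by simp_all
  then have "p z = 0" "q z = 0" by simp_all
  then show ?thesis by (simp add: p_def q_def)
qed

section \<open>The Al-Oboudi operator on power series\<close>

text \<open>The series below have the form \<open>\<Sum> c\<^sub>n z\<^sup>n\<^sup>+\<^sup>1\<close>, as in the definition of the operator:
  the multiplier of \<open>c\<^sub>n\<close> is then \<open>(1 + n \<lambda>)\<^sup>m\<close>, and on the real axis a factor \<open>x\<close> splits off.\<close>

lemma sums_shifted_power_series:
  fixes c :: "nat \<Rightarrow> complex"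
  assumes "(\<lambda>n. c n * z ^ Suc n) sums s"
  shows "(\<lambda>n. (if n = 0 then 0 else c (n - 1)) * z ^ n) sums s"
  using sums_Suc[of "\<lambda>n. (if n = 0 then 0 else c (n - 1)) * z ^ n" s] assms by simp

lemma shifted_power_series_holomorphic:
  assumes "\<forall>z\<in>unit_disc. (\<lambda>n. c n * z ^ Suc n) sums h z"
  shows "h holomorphic_on unit_disc"
  by (rule power_series_holomorphic[where a = "\<lambda>n. if n = 0 then 0 else c (n - 1)"])
     (use assms sums_shifted_power_series[of c] in simp)

lemma shifted_power_series_expansion:
  assumes "\<forall>z\<in>unit_disc. (\<lambda>n. c n * z ^ Suc n) sums h z"
  shows "fps_nth (fps_expansion h 0) (Suc n) = c n"
proof -
  define F where "F = Abs_fps (\<lambda>n. if n = 0 then 0 else c (n - 1))"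
  have "\<forall>\<^sub>F z in nhds 0. z \<in> unit_disc"
    by (intro eventually_nhds_in_open) auto
  then have "h has_fps_expansion F"
    by (intro has_fps_expansionI, elim eventually_mono)
       (use assms sums_shifted_power_series[of c] in \<open>simp add: F_def\<close>)
  then show ?thesis by (simp add: fps_expansion_eqI F_def)
qed

text \<open>Multiplication by \<open>n\<close> is the operator \<open>z d/dz\<close>, and termwise differentiation keeps the disc
  of convergence. The multiplier \<open>(1 + n \<lambda>)\<^sup>m\<close> is then handled by iterating \<open>1 + \<lambda> z d/dz\<close>.\<close>

lemma summable_power_series_times_index:
  fixes c :: "nat \<Rightarrow> complex"
  assumes "\<And>z. cmod z < 1 \<Longrightarrow> summable (\<lambda>n. c n * z ^ n)" and "cmod z < 1"
  shows "summable (\<lambda>n. of_nat n * c n * z ^ n)"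
proof -
  have "summable (\<lambda>n. diffs c n * z ^ n)"
    by (rule termdiff_converges[where K = 1]) (use assms in auto)
  from summable_mult2[OF this, of z] have "summable (\<lambda>n. of_nat (Suc n) * c (Suc n) * z ^ Suc n)"
    by (simp add: diffs_def mult_ac)
  then show ?thesis by (subst (asm) summable_Suc_iff)
qed

lemma summable_al_oboudi_multiplier:
  fixes c :: "nat \<Rightarrow> complex"
  assumes "\<And>z. cmod z < 1 \<Longrightarrow> summable (\<lambda>n. c n * z ^ n)" and "cmod z < 1"
  shows "summable (\<lambda>n. of_real ((1 + real n * lam) ^ m) * c n * z ^ n)"
  using assms(2)
proof (induction m arbitrary: z)
  case 0
  then show ?case using assms(1) by simp
next
  case (Suc m)
  let ?d = "\<lambda>n. of_real ((1 + real n * lam) ^ m) * c n"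
  have "summable (\<lambda>n. ?d n * z ^ n + of_real lam * (of_nat n * ?d n * z ^ n))"
    by (intro summable_add summable_mult summable_power_series_times_index Suc)
  then show ?case by (simp add: algebra_simps)
qed

lemma summable_al_oboudi_multiplier_real:
  fixes c :: "nat \<Rightarrow> real"
  assumes "\<And>z::complex. cmod z < 1 \<Longrightarrow> summable (\<lambda>n. of_real (c n) * z ^ n)" and "\<bar>x\<bar> < 1"
  shows "summable (\<lambda>n. (1 + real n * lam) ^ m * c n * x ^ n)"
proof -
  have "summable (\<lambda>n. of_real ((1 + real n * lam) ^ m) * of_real (c n) * complex_of_real x ^ n)"
    by (rule summable_al_oboudi_multiplier) (use assms in auto)
  then have "summable (\<lambda>n. complex_of_real ((1 + real n * lam) ^ m * c n * x ^ n))"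
    by simp
  then show ?thesis by (rule summable_of_real_iff[THEN iffD1])
qed

lemma al_oboudi_real_axis:
  assumes "\<forall>z\<in>unit_disc. (\<lambda>n. of_real (c n) * z ^ Suc n) sums h z"
    and "\<bar>x\<bar> < 1"
  shows "al_oboudi lam m h (of_real x) = of_real (x * (\<Sum>n. (1 + real n * lam) ^ m * c n * x ^ n))"
    and "summable (\<lambda>n. (1 + real n * lam) ^ m * c n * x ^ n)"
proof -
  have sm: "summable (\<lambda>n. of_real (c n) * z ^ n)" if "cmod z < 1" for z
  proof (cases "z = 0")
    case False
    have "summable (\<lambda>n. of_real (c n) * z ^ Suc n * inverse z)"
      using bspec[OF assms(1), of z] that by (intro summable_mult2) (auto simp: sums_iff)
    with False show ?thesis by (simp add: mult_ac)
  qed simp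
  show s: "summable (\<lambda>n. (1 + real n * lam) ^ m * c n * x ^ n)"
    by (rule summable_al_oboudi_multiplier_real[OF sm assms(2)])
  have "al_oboudi lam m h (of_real x) =
      (\<Sum>n. of_real (x * ((1 + real n * lam) ^ m * c n * x ^ n)))"
    unfolding al_oboudi_def by (simp add: shifted_power_series_expansion[OF assms(1)] mult_ac)
  also have "\<dots> = of_real (\<Sum>n. x * ((1 + real n * lam) ^ m * c n * x ^ n))"
    by (rule suminf_of_real[symmetric]) (intro summable_mult s)
  also have "\<dots> = of_real (x * (\<Sum>n. (1 + real n * lam) ^ m * c n * x ^ n))"
    by (simp add: suminf_mult[OF s])
  finally show "al_oboudi lam m h (of_real x) = \<dots>" .
qed

lemma al_oboudi_harmonic_real_axis:
  assumes "\<forall>z\<in>unit_disc. (\<lambda>n. of_real (p n) * z ^ Suc n) sums h z"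
    and "\<forall>z\<in>unit_disc. (\<lambda>n. of_real (q n) * z ^ Suc n) sums g z"
    and "\<bar>x\<bar> < 1"
  shows "al_oboudi_harmonic lam m h g (of_real x) =
           of_real (x * (\<Sum>n. (1 + real n * lam) ^ m * (p n + (- 1) ^ m * q n) * x ^ n))"
    and "summable (\<lambda>n. (1 + real n * lam) ^ m * (p n + (- 1) ^ m * q n) * x ^ n)"
proof -
  note H = al_oboudi_real_axis[OF assms(1,3), of lam m]
  note G = al_oboudi_real_axis[OF assms(2,3), of lam m]
  let ?P = "\<lambda>n. (1 + real n * lam) ^ m * p n * x ^ n"
  let ?Q = "\<lambda>n. (1 + real n * lam) ^ m * q n * x ^ n"
  have "(\<lambda>n. ?P n + (- 1) ^ m * ?Q n) sums (suminf ?P + (- 1) ^ m * suminf ?Q)"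
    by (intro sums_add sums_mult summable_sums H G)
  also have "(\<lambda>n. ?P n + (- 1) ^ m * ?Q n) =
      (\<lambda>n. (1 + real n * lam) ^ m * (p n + (- 1) ^ m * q n) * x ^ n)"
    by (simp add: algebra_simps)
  finally have s: "(\<lambda>n. (1 + real n * lam) ^ m * (p n + (- 1) ^ m * q n) * x ^ n) sums
      (suminf ?P + (- 1) ^ m * suminf ?Q)" .
  then show "summable (\<lambda>n. (1 + real n * lam) ^ m * (p n + (- 1) ^ m * q n) * x ^ n)"
    by (rule sums_summable)
  show "al_oboudi_harmonic lam m h g (of_real x) =
      of_real (x * (\<Sum>n. (1 + real n * lam) ^ m * (p n + (- 1) ^ m * q n) * x ^ n))"
    unfolding al_oboudi_harmonic_def H(1) G(1) sums_unique[OF s, symmetric]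
    by (simp add: algebra_simps)
qed

section \<open>The defining inequality on the positive radius\<close>

text \<open>The intermediate value theorem on \<open>[0, x]\<close>, starting from the value \<open>c 0\<close> at the origin. It is
  applied to \<open>D\<^sup>v f(x) / x\<close>.\<close>

lemma power_series_pos_if_nonvanishing:
  fixes c :: "nat \<Rightarrow> real"
  assumes sm: "\<And>x. \<bar>x\<bar> < 1 \<Longrightarrow> summable (\<lambda>n. c n * x ^ n)"
    and "c 0 > 0" and nz: "\<And>x. 0 < x \<Longrightarrow> x < 1 \<Longrightarrow> (\<Sum>n. c n * x ^ n) \<noteq> 0"
    and x: "0 < x" "x < 1"
  shows "(\<Sum>n. c n * x ^ n) > 0"
proof (rule ccontr)
  let ?F = "\<lambda>x. \<Sum>n. c n * x ^ n"
  assume "\<not> ?F x > 0"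
  then have "?F x \<le> 0" by simp
  have F0: "?F 0 > 0" using powser_zero[of c] assms(2) by simp
  have cont: "isCont ?F y" if "\<bar>y\<bar> < 1" for y
  proof -
    obtain K where K: "\<bar>y\<bar> < K" "K < 1" using \<open>\<bar>y\<bar> < 1\<close> dense by blast
    show ?thesis by (rule isCont_powser[where K = K]) (use K sm in auto)
  qed
  have "\<exists>y\<ge>0. y \<le> x \<and> ?F y = 0"
    by (rule IVT2) (use \<open>?F x \<le> 0\<close> F0 x cont in auto)
  then obtain y where "0 \<le> y" "y \<le> x" "?F y = 0" by blast
  moreover from this F0 have "y \<noteq> 0" by auto
  ultimately show False using nz[of y] x by auto
qed

text \<open>The case \<open>\<phi> = 0\<close> of the defining inequality, restricted to \<open>z = x > 0\<close>. Positivity of the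
  denominator turns the inequality for the quotient into one that is linear in the
  coefficients; \<open>t n\<close> is the coefficient of \<open>x\<^sup>n\<close> in
  \<open>((1 + k) D\<^sup>u f(x) - (k + \<alpha>) D\<^sup>v f(x)) / x\<close>.\<close>

lemma uniform_starlike_radial_inequality:
  assumes h: "\<forall>z\<in>unit_disc. (\<lambda>n. of_real (p n) * z ^ Suc n) sums h z"
    and g: "\<forall>z\<in>unit_disc. (\<lambda>n. of_real (q n) * z ^ Suc n) sums g z"
    and norm: "p 0 = 1" "\<bar>q 0\<bar> < 1"
    and nz: "\<forall>z\<in>unit_disc - {0}. al_oboudi_harmonic lam v h g z \<noteq> 0"
    and ineq: "\<forall>z\<in>unit_disc - {0}.
       \<alpha> \<le> Re ((1 + of_real k) *
              (al_oboudi_harmonic lam u h g z / al_oboudi_harmonic lam v h g z) - of_real k)"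
    and x: "0 < x" "x < 1"
  defines "t \<equiv> \<lambda>n. (1 + k) * ((1 + real n * lam) ^ u * (p n + (- 1) ^ u * q n)) -
                 (k + \<alpha>) * ((1 + real n * lam) ^ v * (p n + (- 1) ^ v * q n))"
  shows "summable (\<lambda>n. t n * x ^ n) \<and> 0 \<le> (\<Sum>n. t n * x ^ n)"
proof -
  let ?c = "\<lambda>m n. (1 + real n * lam) ^ m * (p n + (- 1) ^ m * q n)"
  let ?F = "\<lambda>m x. \<Sum>n. ?c m n * x ^ n"
  note D = al_oboudi_harmonic_real_axis[OF h g]
  have in_disc: "complex_of_real y \<in> unit_disc - {0}" if "0 < y" "y < 1" for y
    using that by auto
  have abs_lt: "\<bar>y\<bar> < 1" if "0 < y" "y < 1" for y :: real
    using that by simp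
  have pos: "?F v x > 0"
  proof (rule power_series_pos_if_nonvanishing[OF _ _ _ x])
    show "summable (\<lambda>n. ?c v n * y ^ n)" if "\<bar>y\<bar> < 1" for y by (rule D(2)[OF that])
    have "\<bar>(- 1) ^ v * q 0\<bar> < 1" using norm by (simp add: abs_mult)
    then show "?c v 0 > 0" using norm by simp
    show "?F v y \<noteq> 0" if "0 < y" "y < 1" for y
      using bspec[OF nz in_disc[OF that]] unfolding D(1)[of y lam v, OF abs_lt[OF that]]
      by auto
  qed
  have "\<alpha> \<le> (1 + k) * (?F u x / ?F v x) - k"
  proof -
    have "(1 + complex_of_real k) *
        (al_oboudi_harmonic lam u h g (of_real x) / al_oboudi_harmonic lam v h g (of_real x)) - of_real k
        = of_real ((1 + k) * (?F u x / ?F v x) - k)"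
      unfolding D(1)[OF abs_lt[OF x]] using x(1) by simp
    then show ?thesis
      using bspec[OF ineq in_disc[OF x]] by (simp only: Re_complex_of_real)
  qed
  then have "k + \<alpha> \<le> (1 + k) * ?F u x / ?F v x" by simp
  then have nonneg: "0 \<le> (1 + k) * ?F u x - (k + \<alpha>) * ?F v x"
    by (simp only: pos_le_divide_eq[OF pos] diff_ge_0_iff_ge)
  have "(\<lambda>n. (1 + k) * (?c u n * x ^ n) - (k + \<alpha>) * (?c v n * x ^ n)) sums
      ((1 + k) * ?F u x - (k + \<alpha>) * ?F v x)"
    by (intro sums_diff sums_mult summable_sums D(2)) (use x in auto)
  also have "(\<lambda>n. (1 + k) * (?c u n * x ^ n) - (k + \<alpha>) * (?c v n * x ^ n)) = (\<lambda>n. t n * x ^ n)"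
    by (simp add: t_def algebra_simps)
  finally have "(\<lambda>n. t n * x ^ n) sums ((1 + k) * ?F u x - (k + \<alpha>) * ?F v x)" .
  with nonneg show "summable (\<lambda>n. t n * x ^ n) \<and> 0 \<le> (\<Sum>n. t n * x ^ n)"
    by (auto simp: sums_iff)
qed

section \<open>From the radius to the coefficients\<close>

text \<open>A converse of Abel's limit theorem for nonnegative terms. Each partial sum is bounded by the
  whole series at \<open>x < 1\<close>, and a partial sum is continuous at \<open>x = 1\<close>.\<close>

lemma nonneg_series_bounded_by_radial_limit:
  fixes w :: "nat \<Rightarrow> real"
  assumes nn: "\<And>n. 0 \<le> w n"
    and sm: "\<And>x. 0 < x \<Longrightarrow> x < 1 \<Longrightarrow> summable (\<lambda>n. w n * x ^ n)"
    and le: "\<And>x. 0 < x \<Longrightarrow> x < 1 \<Longrightarrow> (\<Sum>n. w n * x ^ n) \<le> M"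
  shows "summable w" "suminf w \<le> M"
proof -
  have part: "sum w {..<N} \<le> M" for N
  proof -
    have "((\<lambda>x. \<Sum>n<N. w n * x ^ n) \<longlongrightarrow> (\<Sum>n<N. w n * 1 ^ n)) (at_left 1)"
      by (intro tendsto_intros)
    moreover have "\<forall>\<^sub>F x in at_left (1::real). x \<in> {0<..<1}"
      by (rule eventually_at_left_real) simp
    then have "\<forall>\<^sub>F x in at_left 1. (\<Sum>n<N. w n * x ^ n) \<le> M"
    proof eventually_elim
      case (elim x)
      then have "(\<Sum>n<N. w n * x ^ n) \<le> (\<Sum>n. w n * x ^ n)"
        by (intro sum_le_suminf sm) (auto simp: nn)
      with le[of x] elim show ?case by simp
    qed
    ultimately have "(\<Sum>n<N. w n * 1 ^ n) \<le> M"
      by (rule tendsto_upperbound) simp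
    then show ?thesis by simp
  qed
  show "summable w" by (rule summableI_nonneg_bounded[OF nn part])
  then show "suminf w \<le> M" using part by (rule suminf_le_const)
qed

text \<open>Factor out \<open>x\<^sup>v\<close>: both \<open>x\<^sup>v\<close> and \<open>x\<^sup>u\<^sup>-\<^sup>v C - E\<close> are nonnegative and increasing for \<open>x \<ge> 1\<close>.\<close>

lemma power_difference_mono:
  fixes x y C E :: real
  assumes "1 \<le> x" "x \<le> y" "0 \<le> E" "E \<le> C" "v \<le> u"
  shows "x ^ u * C - x ^ v * E \<le> y ^ u * C - y ^ v * E"
proof -
  have "x ^ v * (x ^ (u - v) * C - E) \<le> y ^ v * (y ^ (u - v) * C - E)"
  proof (rule mult_mono)
    show "x ^ v \<le> y ^ v" "0 \<le> y ^ v" using assms by (auto intro: power_mono)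
    show "x ^ (u - v) * C - E \<le> y ^ (u - v) * C - E"
      using assms by (auto intro!: mult_right_mono power_mono)
    have "1 * C \<le> x ^ (u - v) * C"
      using assms by (intro mult_right_mono one_le_power) auto
    then show "0 \<le> x ^ (u - v) * C - E" using assms by simp
  qed
  moreover have "z ^ v * (z ^ (u - v) * C - E) = z ^ u * C - z ^ v * E" for z :: real
    using assms(5) by (simp add: right_diff_distrib mult.assoc[symmetric] power_add[symmetric])
  ultimately show ?thesis by simp
qed

text \<open>With \<open>A n = |a\<^sub>n\<^sub>+\<^sub>1|\<close> and \<open>B n = |b\<^sub>n\<^sub>+\<^sub>1|\<close> the series in the radial inequality has a single
  possibly positive coefficient, \<open>t 0\<close>; every later one is at most \<open>- K (A n + B n)\<close>. The
  radial inequality therefore bounds the series of the \<open>- t n\<close>, \<open>n \<ge> 1\<close>, by \<open>t 0\<close>.\<close>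

lemma uniform_starlike_tail_bound:
  fixes A B :: "nat \<Rightarrow> real" and \<alpha> k lam s :: real
  assumes par: "0 \<le> lam" "0 \<le> \<alpha>" "\<alpha> < 1" "0 \<le> k" "v < u" and s: "\<bar>s\<bar> \<le> 1"
    and nn: "\<And>n. 0 \<le> A n" "\<And>n. 0 \<le> B n"
  defines "t \<equiv> \<lambda>n. (1 + k) * ((1 + real n * lam) ^ u * ((if n = 0 then 1 else - A n) - B n)) -
                 (k + \<alpha>) * ((1 + real n * lam) ^ v * ((if n = 0 then 1 else - A n) - s * B n))"
    and "K \<equiv> (1 + lam) ^ u * (1 + k) - (1 + lam) ^ v * (k + \<alpha>)"
  assumes radial: "\<And>x. 0 < x \<Longrightarrow> x < 1 \<Longrightarrow> summable (\<lambda>n. t n * x ^ n) \<and> 0 \<le> (\<Sum>n. t n * x ^ n)"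
  shows "summable (\<lambda>n. A (Suc n) + B (Suc n))"
    and "(\<Sum>n. A (Suc n) + B (Suc n)) \<le> (1 - \<alpha> - (1 + k - s * (k + \<alpha>)) * B 0) / K"
proof -
  \<comment> \<open>comparison with \<open>y = 1\<close>, where the expression equals \<open>1 - \<alpha> > 0\<close>\<close>
  have "1 ^ u * (1 + k) - 1 ^ v * (k + \<alpha>) \<le> K"
    unfolding K_def by (rule power_difference_mono) (use par in auto)
  then have K: "K > 0" using par by simp
  have tail: "K * (A (Suc n) + B (Suc n)) \<le> - t (Suc n)" for n
  proof -
    let ?c = "1 + real (Suc n) * lam"
    let ?L = "?c ^ u * (1 + k) - ?c ^ v * (k + \<alpha>)"
    have c: "1 + lam \<le> ?c" using par by (simp add: algebra_simps)
    have L: "K \<le> ?L"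
      unfolding K_def by (rule power_difference_mono) (use par c in auto)
    \<comment> \<open>the weight of \<open>B\<close> carries the sign \<open>s\<close>, which can only increase it\<close>
    have "s * (?c ^ v * (k + \<alpha>) * B (Suc n)) \<le> 1 * (?c ^ v * (k + \<alpha>) * B (Suc n))"
      by (rule mult_right_mono) (use s par nn c in auto)
    then have "?L * (A (Suc n) + B (Suc n)) \<le> - t (Suc n)"
      by (simp add: t_def algebra_simps)
    moreover have "K * (A (Suc n) + B (Suc n)) \<le> ?L * (A (Suc n) + B (Suc n))"
      using L nn by (intro mult_right_mono) auto
    ultimately show ?thesis by linarith
  qed
  have wnn: "0 \<le> - t (Suc n)" for n
    using tail[of n] K nn by (smt (verit, best) add_nonneg_nonneg mult_nonneg_nonneg)
  define w where "w = (\<lambda>n. if n = 0 then 0 else - t n)"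
  have w: "(\<lambda>n. w n * x ^ n) sums (t 0 - (\<Sum>n. t n * x ^ n))" if "0 < x" "x < 1" for x
  proof -
    have "(\<lambda>n. (if n = 0 then t 0 else 0) - t n * x ^ n) sums (t 0 - (\<Sum>n. t n * x ^ n))"
      by (intro sums_diff summable_sums radial[THEN conjunct1] that)
         (use sums_single[of 0 "\<lambda>_. t 0"] in simp)
    also have "(\<lambda>n. (if n = 0 then t 0 else 0) - t n * x ^ n) = (\<lambda>n. w n * x ^ n)"
      by (auto simp: w_def)
    finally show ?thesis .
  qed
  have W: "summable w" "suminf w \<le> t 0"
  proof -
    have a: "0 \<le> w n" for n using wnn[of "n - 1"] by (cases n) (auto simp: w_def)
    have b: "summable (\<lambda>n. w n * x ^ n)" if "0 < x" "x < 1" for x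
      using w[OF that] by (rule sums_summable)
    have c: "(\<Sum>n. w n * x ^ n) \<le> t 0" if "0 < x" "x < 1" for x
      using sums_unique[OF w[OF that]] radial[OF that] by simp
    show "summable w" "suminf w \<le> t 0"
      using nonneg_series_bounded_by_radial_limit[OF a b c] by auto
  qed
  have W': "(\<lambda>n. w (Suc n) / K) sums (suminf w / K)"
    using summable_sums[OF W(1)] sums_Suc_iff[of w "suminf w"]
    by (intro sums_divide) (simp add: w_def)
  have le: "A (Suc n) + B (Suc n) \<le> w (Suc n) / K" for n
    using mult_imp_le_div_pos[OF K, of _ "- t (Suc n)"] tail[of n] by (simp add: w_def mult.commute)
  show sm: "summable (\<lambda>n. A (Suc n) + B (Suc n))"
    by (rule summable_comparison_test'[OF sums_summable[OF W'], of 0]) (use le nn in auto)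
  have "(\<Sum>n. A (Suc n) + B (Suc n)) \<le> suminf w / K"
    using suminf_le[OF le sm sums_summable[OF W']] sums_unique[OF W'] by simp
  also have "\<dots> \<le> t 0 / K" using W(2) K by (simp add: divide_right_mono)
  also have "t 0 = 1 - \<alpha> - (1 + k - s * (k + \<alpha>)) * B 0"
    by (simp add: t_def algebra_simps)
  finally show "(\<Sum>n. A (Suc n) + B (Suc n)) \<le> \<dots> / K" .
qed

section \<open>The growth estimate\<close>

lemma norm_power_series_tail_le:
  fixes c :: "nat \<Rightarrow> complex"
  assumes "summable d" "\<And>n. cmod (c n) \<le> d n" "cmod z < 1" "(\<lambda>n. c n * z ^ (n + 2)) sums s"
  shows "cmod s \<le> suminf d * (cmod z)\<^sup>2"
proof -
  have le: "cmod (c n * z ^ (n + 2)) \<le> d n * (cmod z)\<^sup>2" for n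
  proof -
    have "cmod z ^ (n + 2) \<le> (cmod z)\<^sup>2"
      using assms(3) by (intro power_decreasing) auto
    then show ?thesis
      unfolding norm_mult norm_power
      using assms(2)[of n] by (intro mult_mono) (auto intro: order_trans[OF norm_ge_zero])
  qed
  have "cmod (\<Sum>n. c n * z ^ (n + 2)) \<le> (\<Sum>n. d n * (cmod z)\<^sup>2)"
    by (rule norm_suminf_le[OF le]) (intro summable_mult2 assms)
  then show ?thesis
    using sums_unique[OF assms(4)] suminf_mult2[OF assms(1), of "(cmod z)\<^sup>2"] by simp
qed

theorem theorem2p4:
  fixes k \<alpha> lam r \<sigma> \<tau> :: real and u v :: nat
    and f :: "complex \<Rightarrow> complex" and a b :: "nat \<Rightarrow> complex" and z :: complex
  assumes "lam \<ge> 0" and "0 \<le> \<alpha>" and "\<alpha> < 1" and "0 \<le> k" and "u \<ge> 1" and "u > v"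
    and "f \<in> UTH k u v \<alpha> lam"
    and "negative_form u a b f"
    and "cmod z = r" and "r < 1"
    and "\<sigma> = (1 - \<alpha>) / ((1 + lam) ^ u * (1 + k) - (1 + lam) ^ v * (k + \<alpha>))"
    and "\<tau> = ((1 + k) - (- 1) powi (int v - int u) * (k + \<alpha>)) /
             ((1 + lam) ^ u * (1 + k) - (1 + lam) ^ v * (k + \<alpha>))"
  shows "cmod (f z) \<le> (1 + cmod (b 1)) * r + (\<sigma> - \<tau> * cmod (b 1)) * r\<^sup>2 \<and>
         cmod (f z) \<ge> (1 - cmod (b 1)) * r - (\<sigma> - \<tau> * cmod (b 1)) * r\<^sup>2"
proof -
  \<comment> \<open>\<open>p\<close> and \<open>q\<close> are the coefficients of the analytic and the co-analytic part, shifted by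
    one; the entry \<open>A 0\<close> is not a coefficient of \<open>f\<close> and is masked in \<open>p\<close> by the leading \<open>1\<close>\<close>
  define A B where "A = (\<lambda>n. cmod (a (Suc n)))" and "B = (\<lambda>n. cmod (b (Suc n)))"
  define e :: real where "e = (- 1) ^ (u - 1)"
  define s :: real where "s = (- 1) powi (int v - int u)"
  define p q where "p = (\<lambda>n. if n = 0 then 1 else - A n)" and "q = (\<lambda>n. e * B n)"
  have b1: "B 0 = cmod (b 1)" "B 0 < 1"
    using assms(8) by (auto simp: B_def negative_form_def)
  have s_eq: "s = (- 1) ^ (u - v)"
    using assms(6) by (simp add: s_def power_int_def power_inverse[symmetric] nat_diff_distrib)
  have e_abs: "\<bar>e\<bar> = 1" by (simp add: e_def)
  \<comment> \<open>these signs make the coefficients past the linear term proportional to \<open>- (A n + B n)\<close>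
    in \<open>D\<^sup>u f\<close> and to \<open>- (A n + s B n)\<close> in \<open>D\<^sup>v f\<close>\<close>
  have eu: "(- 1) ^ u * e = -1"
    using assms(5) unfolding e_def power_add[symmetric] by simp
  have ev: "(- 1) ^ v * e = - s"
  proof -
    have "(- 1) ^ u = (- 1) ^ v * s"
      using assms(6) unfolding s_eq power_add[symmetric] by simp
    with eu have "(- 1) ^ v * e * s = - 1" by (simp add: mult_ac)
    moreover have "s = 1 \<or> s = -1"
      unfolding s_eq by (cases "even (u - v)") auto
    ultimately show ?thesis by auto
  qed
  from assms(7) obtain h g where rep: "canonical_rep f h g"
    and nz: "\<forall>z\<in>unit_disc - {0}. al_oboudi_harmonic lam v h g z \<noteq> 0"
    and ineq: "\<And>z \<phi>. z \<in> unit_disc - {0} \<Longrightarrow>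
       \<alpha> \<le> Re ((1 + of_real k * cis \<phi>) *
              (al_oboudi_harmonic lam u h g z / al_oboudi_harmonic lam v h g z) - of_real k * cis \<phi>)"
    unfolding UTH_def USH_def by blast
  from assms(8) obtain h' g' where form:
    "\<And>z. z \<in> unit_disc \<Longrightarrow> (\<lambda>n. of_real (cmod (a (n + 2))) * z ^ (n + 2)) sums (z - h' z)"
    "\<And>z. z \<in> unit_disc \<Longrightarrow> (\<lambda>n. (- 1) ^ (u - 1) * of_real (cmod (b (n + 1))) * z ^ (n + 1)) sums g' z"
    "\<And>z. z \<in> unit_disc \<Longrightarrow> f z = h' z + cnj (g' z)"
    unfolding negative_form_def by blast
  have h': "\<forall>z\<in>unit_disc. (\<lambda>n. of_real (p n) * z ^ Suc n) sums h' z"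
  proof
    fix z :: complex assume that: "z \<in> unit_disc"
    show "(\<lambda>n. of_real (p n) * z ^ Suc n) sums h' z"
      using sums_Suc[of "\<lambda>n. of_real (p n) * z ^ Suc n" "h' z - z"] sums_minus[OF form(1)[OF that]]
      by (simp add: p_def A_def)
  qed
  have g': "\<forall>z\<in>unit_disc. (\<lambda>n. of_real (q n) * z ^ Suc n) sums g' z"
  proof
    fix z :: complex assume that: "z \<in> unit_disc"
    show "(\<lambda>n. of_real (q n) * z ^ Suc n) sums g' z"
      using form(2)[OF that] by (simp add: q_def B_def e_def)
  qed
  have "g' 0 = 0"
    using bspec[OF g', of 0] sums_unique2[OF sums_zero, of "g' 0"] by simp
  have eq: "h z = h' z \<and> g z = g' z" if "z \<in> unit_disc" for z
    by (rule harmonic_decomposition_unique[where S = unit_disc and w = 0])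
       (use rep \<open>g' 0 = 0\<close> form(3) that shifted_power_series_holomorphic[OF h']
          shifted_power_series_holomorphic[OF g'] in \<open>auto simp: canonical_rep_def\<close>)
  have h: "\<forall>z\<in>unit_disc. (\<lambda>n. of_real (p n) * z ^ Suc n) sums h z"
    using h' eq by simp
  have g: "\<forall>z\<in>unit_disc. (\<lambda>n. of_real (q n) * z ^ Suc n) sums g z"
    using g' eq by simp
  have pu: "p n + (- 1) ^ u * q n = (if n = 0 then 1 else - A n) - B n" for n
    using eu by (simp add: p_def q_def mult.assoc[symmetric])
  have pv: "p n + (- 1) ^ v * q n = (if n = 0 then 1 else - A n) - s * B n" for n
    using ev by (simp add: p_def q_def mult.assoc[symmetric])
  have pq0: "p 0 = 1" "\<bar>q 0\<bar> < 1"
    using b1 e_abs by (auto simp: p_def q_def abs_mult B_def)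
  have ineq0: "\<forall>z\<in>unit_disc - {0}. \<alpha> \<le> Re ((1 + of_real k) *
      (al_oboudi_harmonic lam u h g z / al_oboudi_harmonic lam v h g z) - of_real k)"
    using ineq[of _ 0] by simp
  note radial = uniform_starlike_radial_inequality[OF h g pq0 nz ineq0, unfolded pu pv]
  have s_abs: "\<bar>s\<bar> \<le> 1" by (simp add: s_eq)
  have nn: "0 \<le> A n" "0 \<le> B n" for n by (auto simp: A_def B_def)
  note tail = uniform_starlike_tail_bound[OF assms(1-4,6) s_abs nn radial]
  have sA: "summable (\<lambda>n. A (Suc n))" and sB: "summable (\<lambda>n. B (Suc n))"
    by (rule summable_comparison_test'[OF tail(1), of 0]; use nn in simp)+
  have "(\<Sum>n. A (Suc n) + B (Suc n)) \<le> \<sigma> - \<tau> * cmod (b 1)"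
    using tail(2) unfolding assms(11,12) s_def[symmetric] b1(1)
    by (simp only: diff_divide_distrib[of "1 - \<alpha>"] times_divide_eq_left)
  then have AB: "(\<Sum>n. A (Suc n)) + (\<Sum>n. B (Suc n)) \<le> \<sigma> - \<tau> * cmod (b 1)"
    using suminf_add[OF sA sB] by simp
  have z: "z \<in> unit_disc" "cmod z < 1" using assms(9,10) by auto
  have H: "cmod (h z - z) \<le> (\<Sum>n. A (Suc n)) * r\<^sup>2"
    unfolding assms(9)[symmetric]
    by (rule norm_power_series_tail_le[OF sA _ z(2), where c = "\<lambda>n. of_real (p (Suc n))"])
       (use sums_Suc_iff[of "\<lambda>n. of_real (p n) * z ^ Suc n" "h z - z"] bspec[OF h z(1)] nn
        in \<open>auto simp: p_def\<close>)
  have G: "cmod (g z - of_real (q 0) * z) \<le> (\<Sum>n. B (Suc n)) * r\<^sup>2"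
    unfolding assms(9)[symmetric]
    by (rule norm_power_series_tail_le[OF sB _ z(2), where c = "\<lambda>n. of_real (q (Suc n))"])
       (use sums_Suc_iff[of "\<lambda>n. of_real (q n) * z ^ Suc n" "g z - of_real (q 0) * z"] bspec[OF g z(1)] nn e_abs
        in \<open>auto simp: q_def abs_mult norm_mult\<close>)
  define R where "R = (h z - z) + cnj (g z - of_real (q 0) * z)"
  have "cmod R \<le> cmod (h z - z) + cmod (g z - of_real (q 0) * z)"
    unfolding R_def by (metis norm_triangle_ineq complex_mod_cnj)
  also have "\<dots> \<le> ((\<Sum>n. A (Suc n)) + (\<Sum>n. B (Suc n))) * r\<^sup>2"
    using H G by (simp add: distrib_right)
  also have "\<dots> \<le> (\<sigma> - \<tau> * cmod (b 1)) * r\<^sup>2"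
    using AB by (rule mult_right_mono) simp
  finally have R: "cmod R \<le> (\<sigma> - \<tau> * cmod (b 1)) * r\<^sup>2" .
  have "f z = z + of_real (q 0) * cnj z + R"
    using rep z(1) by (simp add: canonical_rep_def R_def)
  moreover have "cmod (of_real (q 0) * cnj z) = cmod (b 1) * r"
    using e_abs b1(1) assms(9) by (simp add: q_def norm_mult abs_mult B_def)
  ultimately have "cmod (f z) \<le> r + cmod (b 1) * r + cmod R"
    and "r - cmod (b 1) * r - cmod R \<le> cmod (f z)"
    using assms(9) norm_triangle_ineq[of "z + of_real (q 0) * cnj z" R]
      norm_triangle_ineq[of z "of_real (q 0) * cnj z"]
      norm_diff_ineq[of "z + of_real (q 0) * cnj z" R]
      norm_diff_ineq[of z "of_real (q 0) * cnj z"] by simp_all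
  with R show ?thesis by (simp add: algebra_simps)
qed

end
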